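(* Let $(X,\|\cdot\|_X)$ be a real Banach space. For any gauge $\varphi$, the function $\Psi_\varphi$ is Euler--Legendre if and only if $(X,\|\cdot\|_X)$ is strictly convex and Gateaux differentiable.
   Context: A gauge is a strictly increasing continuous function $\varphi:[0,\infty[\to[0,\infty[$ with $\varphi(0)=0$ and $\lim_{t\to\infty}\varphi(t)=\infty$. $\Psi_\varphi(x)=\int_0^{\|x\|_X}\varphi(t)\,dt$ for $x\in X$. $(X,\|\cdot\|_X)$ is strictly convex iff $\|\frac{x+y}{2}\|<1$ for all distinct unit vectors $x,y$; it is Gateaux differentiable iff the norm is Gateaux differentiable at every $x\ne0$. For a proper convex lower semicontinuous $\Psi:X\to\,]-\infty,\infty]$ with subdifferential $\partial\Psi:X\to2^{X^*}$, $\mathrm{dom}\,\partial\Psi=\{x:\partial\Psi(x)\neq\varnothing\}$, $(\partial\Psi)^{-1}(y)=\{x:y\in\partial\Psi(x)\}$: $\Psi$ is essentially Gateaux differentiable iff its domain of finiteness has nonempty interior and $\partial\Psi(x)$ is a singleton for every $x\in\mathrm{dom}\,\partial\Psi$; essentially strictly convex iff it is strictly convex on every convex subset of $\mathrm{dom}\,\partial\Psi$ and $(\partial\Psi)^{-1}$ is locally bounded on its domain (every $y\in X^*$ with $(\partial\Psi)^{-1}(y)\ne\varnothing$ has a ball around it whose image under $(\partial\Psi)^{-1}$ is bounded); Euler--Legendre iff both. *)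

theory Defs
  imports "HOL-Analysis.Analysis"
begin

text \<open>A gauge is a function on the half-line; values of \<open>\<phi>\<close> at negative arguments are irrelevant.
  (The constant \<open>gauge\<close> of HOL-Analysis is the unrelated notion from gauge integration.)\<close>

definition gauge_fun :: "(real \<Rightarrow> real) \<Rightarrow> bool" where
  "gauge_fun \<phi> \<longleftrightarrow>
     \<phi> \<in> {0..} \<rightarrow> {0..} \<and> strict_mono_on {0..} \<phi> \<and> continuous_on {0..} \<phi> \<and>
     \<phi> 0 = 0 \<and> filterlim \<phi> at_top at_top"

definition gauge_potential :: "(real \<Rightarrow> real) \<Rightarrow> 'a::real_normed_vector \<Rightarrow> ereal" where
  "gauge_potential \<phi> x = ereal (integral {0..norm x} \<phi>)"

definition strictly_convex_space :: "'a::real_normed_vector itself \<Rightarrow> bool" where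
  "strictly_convex_space _ \<longleftrightarrow>
     (\<forall>x y :: 'a. norm x = 1 \<longrightarrow> norm y = 1 \<longrightarrow> x \<noteq> y \<longrightarrow> norm ((x + y) /\<^sub>R 2) < 1)"

text \<open>The directional derivatives at \<open>x\<close> are two-sided, and they must be given by a continuous
  linear functional.\<close>

definition gateaux_differentiable_at :: "('a::real_normed_vector \<Rightarrow> real) \<Rightarrow> 'a \<Rightarrow> bool" where
  "gateaux_differentiable_at f x \<longleftrightarrow>
     (\<exists>D :: 'a \<Rightarrow>\<^sub>L real. \<forall>h.
        ((\<lambda>t. f (x + t *\<^sub>R h)) has_real_derivative blinfun_apply D h) (at 0))"

definition gateaux_differentiable_space :: "'a::real_normed_vector itself \<Rightarrow> bool" where
  "gateaux_differentiable_space _ \<longleftrightarrow>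
     (\<forall>x :: 'a. x \<noteq> 0 \<longrightarrow> gateaux_differentiable_at norm x)"

definition proper_fun :: "('a \<Rightarrow> ereal) \<Rightarrow> bool" where
  "proper_fun \<Psi> \<longleftrightarrow> (\<forall>x. \<Psi> x \<noteq> -\<infinity>) \<and> (\<exists>x. \<Psi> x \<noteq> \<infinity>)"

definition convex_ereal_fun :: "('a::real_vector \<Rightarrow> ereal) \<Rightarrow> bool" where
  "convex_ereal_fun \<Psi> \<longleftrightarrow>
     (\<forall>x y. \<forall>t::real. 0 < t \<longrightarrow> t < 1 \<longrightarrow>
        \<Psi> (t *\<^sub>R x + (1 - t) *\<^sub>R y) \<le> ereal t * \<Psi> x + ereal (1 - t) * \<Psi> y)"

definition strictly_convex_ereal_on :: "'a::real_vector set \<Rightarrow> ('a \<Rightarrow> ereal) \<Rightarrow> bool" where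
  "strictly_convex_ereal_on C \<Psi> \<longleftrightarrow>
     (\<forall>x\<in>C. \<forall>y\<in>C. \<forall>t::real. x \<noteq> y \<longrightarrow> 0 < t \<longrightarrow> t < 1 \<longrightarrow>
        \<Psi> (t *\<^sub>R x + (1 - t) *\<^sub>R y) < ereal t * \<Psi> x + ereal (1 - t) * \<Psi> y)"

definition lsc_fun :: "('a::topological_space \<Rightarrow> ereal) \<Rightarrow> bool" where
  "lsc_fun \<Psi> \<longleftrightarrow> (\<forall>x. \<Psi> x \<le> Liminf (at x) \<Psi>)"

definition finiteness_domain :: "('a \<Rightarrow> ereal) \<Rightarrow> 'a set" where
  "finiteness_domain \<Psi> = {x. \<bar>\<Psi> x\<bar> \<noteq> \<infinity>}"

definition subdiff :: "('a::real_normed_vector \<Rightarrow> ereal) \<Rightarrow> 'a \<Rightarrow> ('a \<Rightarrow>\<^sub>L real) set" where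
  "subdiff \<Psi> x =
     {y. x \<in> finiteness_domain \<Psi> \<and> (\<forall>z. \<Psi> x + ereal (blinfun_apply y (z - x)) \<le> \<Psi> z)}"

definition dom_subdiff :: "('a::real_normed_vector \<Rightarrow> ereal) \<Rightarrow> 'a set" where
  "dom_subdiff \<Psi> = {x. subdiff \<Psi> x \<noteq> {}}"

definition inv_subdiff :: "('a::real_normed_vector \<Rightarrow> ereal) \<Rightarrow> ('a \<Rightarrow>\<^sub>L real) \<Rightarrow> 'a set" where
  "inv_subdiff \<Psi> y = {x. y \<in> subdiff \<Psi> x}"

definition locally_bounded_on_domain ::
    "('a::metric_space \<Rightarrow> 'b::metric_space set) \<Rightarrow> bool" where
  "locally_bounded_on_domain T \<longleftrightarrow>
     (\<forall>y. T y \<noteq> {} \<longrightarrow> (\<exists>r>0. bounded (\<Union>z\<in>ball y r. T z)))"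

definition essentially_gateaux_differentiable ::
    "('a::real_normed_vector \<Rightarrow> ereal) \<Rightarrow> bool" where
  "essentially_gateaux_differentiable \<Psi> \<longleftrightarrow>
     interior (finiteness_domain \<Psi>) \<noteq> {} \<and>
     (\<forall>x\<in>dom_subdiff \<Psi>. is_singleton (subdiff \<Psi> x))"

definition essentially_strictly_convex :: "('a::real_normed_vector \<Rightarrow> ereal) \<Rightarrow> bool" where
  "essentially_strictly_convex \<Psi> \<longleftrightarrow>
     (\<forall>C. convex C \<longrightarrow> C \<subseteq> dom_subdiff \<Psi> \<longrightarrow> strictly_convex_ereal_on C \<Psi>) \<and>
     locally_bounded_on_domain (inv_subdiff \<Psi>)"

text \<open>Essential Gateaux differentiability and essential strict convexity are only considered for
  proper convex lower semicontinuous functions; this standing assumption is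
  made part of the final predicate.\<close>

definition euler_legendre :: "('a::real_normed_vector \<Rightarrow> ereal) \<Rightarrow> bool" where
  "euler_legendre \<Psi> \<longleftrightarrow>
     proper_fun \<Psi> \<and> convex_ereal_fun \<Psi> \<and> lsc_fun \<Psi> \<and>
     essentially_gateaux_differentiable \<Psi> \<and> essentially_strictly_convex \<Psi>"

end

theory Submission
  imports Defs
begin

text \<open>The primitive \<open>F\<close> of the gauge satisfies the strict tangent inequality
  \<open>F a + \<phi> a * (b - a) < F b\<close>. Hence \<open>\<phi> \<parallel>x\<parallel>\<close> times a subgradient of the norm at \<open>x\<close> is a
  subgradient of the potential at \<open>x\<close>. By Hahn--Banach, for each direction \<open>h\<close> some subgradient of
  the norm attains the right derivative of the norm along \<open>h\<close>. So the subdifferential of the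
  potential is nonempty everywhere, and if it is a singleton at \<open>x \<noteq> 0\<close>, all right derivatives come
  from one functional and the norm is Gateaux differentiable at \<open>x\<close>. Conversely the chain rule
  determines every subgradient off the origin, where \<open>\<phi> 0 = 0\<close> forces it to vanish. Strict convexity
  passes between the norm and the potential since \<open>F\<close> is increasing and strictly convex, and
  superlinear growth of \<open>F\<close> always gives local boundedness of the inverse subdifferential.\<close>

subsection \<open>Sublinear functionals and the Hahn--Banach theorem\<close>

text \<open>Homogeneity is asked only as an inequality for positive factors, a form that is easy to
  check for infima; equality follows below by rescaling with the inverse factor.\<close>

definition sublinear :: "('a::real_vector \<Rightarrow> real) \<Rightarrow> bool" where
  "sublinear p \<longleftrightarrow>
     (\<forall>x y. p (x + y) \<le> p x + p y) \<and> (\<forall>c x. 0 < c \<longrightarrow> p (c *\<^sub>R x) \<le> c * p x)"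

lemma sublinear_add: "sublinear p \<Longrightarrow> p (x + y) \<le> p x + p y"
  by (simp add: sublinear_def)

lemma sublinear_zero:
  assumes "sublinear p"
  shows "p 0 = 0"
proof -
  have "p 0 \<le> c * p 0" if "0 < c" for c
    using assms that unfolding sublinear_def by (metis scaleR_zero_right)
  \<comment> \<open>The factor 2 yields \<open>0 \<le> p 0\<close>, the factor 1/2 yields
    \<open>p 0 \<le> 0\<close>.\<close>
  from this[of 2] this[of "1/2"] show ?thesis by simp
qed

lemma sublinear_scale:
  assumes p: "sublinear p" and c: "0 \<le> c"
  shows "p (c *\<^sub>R x) = c * p x"
proof (cases "c = 0")
  case True
  then show ?thesis by (simp add: sublinear_zero[OF p])
next
  case False
  with c have c: "0 < c" by simp
  have "p (inverse c *\<^sub>R c *\<^sub>R x) \<le> inverse c * p (c *\<^sub>R x)"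
    using p c unfolding sublinear_def by (metis positive_imp_inverse_positive)
  then have "c * p x \<le> p (c *\<^sub>R x)"
    using c by (simp add: field_simps)
  moreover have "p (c *\<^sub>R x) \<le> c * p x"
    using p c by (simp add: sublinear_def)
  ultimately show ?thesis by simp
qed

lemma sublinear_minus:
  assumes "sublinear p"
  shows "- p (- x) \<le> p x"
  using sublinear_add[OF assms, of x "- x"] sublinear_zero[OF assms] by simp

text \<open>Subadditivity for the sum of \<open>x + y\<close> and \<open>- y\<close> is the reverse
  inequality once \<open>p (- y) = - p y\<close>; oddness also reduces negative scalars to positive
  ones.\<close>

lemma sublinear_odd_imp_linear:
  assumes p: "sublinear p" and odd: "\<And>x. p (- x) = - p x"
  shows "linear p"
proof (rule linearI)
  show "p (x + y) = p x + p y" for x y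
    using sublinear_add[OF p, of x y] sublinear_add[OF p, of "x + y" "- y"] odd[of y] by simp
  show "p (c *\<^sub>R x) = c *\<^sub>R p x" for c x
  proof (cases "0 \<le> c")
    case True
    then show ?thesis by (simp add: sublinear_scale[OF p])
  next
    case False
    then show ?thesis
      using sublinear_scale[OF p, of "- c" x] odd[of "c *\<^sub>R x"] by simp
  qed
qed

text \<open>Since \<open>k\<close> may depend on \<open>i\<close>, \<open>j\<close> and the points,
  the infima on the right can be taken over \<open>i\<close> and \<open>j\<close> independently.
  This serves the shifted functionals, the chains in Zorn's lemma and the difference quotients
  alike.\<close>

lemma sublinear_INF:
  fixes f :: "'i \<Rightarrow> 'a::real_vector \<Rightarrow> real"
  assumes I: "I \<noteq> {}"
    and bdd: "\<And>x. bdd_below ((\<lambda>i. f i x) ` I)"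
    and add: "\<And>i j x y. i \<in> I \<Longrightarrow> j \<in> I \<Longrightarrow> \<exists>k\<in>I. f k (x + y) \<le> f i x + f j y"
    and scale: "\<And>i c x. i \<in> I \<Longrightarrow> 0 < c \<Longrightarrow> \<exists>k\<in>I. f k (c *\<^sub>R x) \<le> c * f i x"
  shows "sublinear (\<lambda>x. INF i\<in>I. f i x)"
  unfolding sublinear_def
proof (intro conjI allI impI)
  let ?q = "\<lambda>x. INF i\<in>I. f i x"
  fix x y :: 'a
  have le: "?q (x + y) \<le> f i x + f j y" if ij: "i \<in> I" "j \<in> I" for i j
  proof -
    obtain k where "k \<in> I" "f k (x + y) \<le> f i x + f j y"
      using add[OF ij] by blast
    then show ?thesis using cINF_lower[OF bdd, of k "x + y"] by simp
  qed
  have "?q (x + y) - f i x \<le> ?q y" if "i \<in> I" for i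
    using le[OF that] by (intro cINF_greatest[OF I]) (simp add: algebra_simps)
  then have "?q (x + y) - ?q y \<le> ?q x"
    by (intro cINF_greatest[OF I]) (simp add: algebra_simps)
  then show "?q (x + y) \<le> ?q x + ?q y" by simp
next
  let ?q = "\<lambda>x. INF i\<in>I. f i x"
  fix c :: real and x :: 'a
  assume c: "0 < c"
  have "?q (c *\<^sub>R x) \<le> c * f i x" if i: "i \<in> I" for i
  proof -
    obtain k where "k \<in> I" "f k (c *\<^sub>R x) \<le> c * f i x"
      using scale[OF i c] by blast
    then show ?thesis using cINF_lower[OF bdd, of k "c *\<^sub>R x"] by simp
  qed
  then have "?q (c *\<^sub>R x) / c \<le> ?q x"
    using c by (intro cINF_greatest[OF I]) (simp add: field_simps)
  then show "?q (c *\<^sub>R x) \<le> c * ?q x"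
    using c by (simp add: field_simps)
qed

text \<open>The witness is the infimum of \<open>p (x + t h) - t p h\<close> over
  \<open>t \<ge> 0\<close>: taking \<open>t = 0\<close> puts it below \<open>p\<close>, and
  \<open>t = 1\<close> at \<open>- h\<close> gives the last claim.\<close>

lemma sublinear_decrease:
  fixes p :: "'a::real_vector \<Rightarrow> real"
  assumes p: "sublinear p"
  obtains q where "sublinear q" "q \<le> p" "q (- h) \<le> - p h"
proof
  let ?f = "\<lambda>t x. p (x + t *\<^sub>R h) - t * p h"
  let ?q = "\<lambda>x. INF t\<in>{0..}. ?f t x"
  \<comment> \<open>The lower bound comes from
    \<open>t p h = p (t h) \<le> p (x + t h) + p (- x)\<close>.\<close>
  have bdd: "bdd_below ((\<lambda>t. ?f t x) ` {0..})" for x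
  proof (rule bdd_belowI2)
    fix t :: real assume "t \<in> {0..}"
    then show "- p (- x) \<le> ?f t x"
      using sublinear_add[OF p, of "x + t *\<^sub>R h" "- x"] sublinear_scale[OF p, of t h] by simp
  qed
  show "sublinear ?q"
  proof (rule sublinear_INF[OF _ bdd])
    fix s t :: real and x y :: 'a
    assume "s \<in> {0..}" "t \<in> {0..}"
    then have "s + t \<in> {0..}" by simp
    moreover have "?f (s + t) (x + y) \<le> ?f s x + ?f t y"
      using sublinear_add[OF p, of "x + s *\<^sub>R h" "y + t *\<^sub>R h"] by (simp add: algebra_simps)
    ultimately show "\<exists>k\<in>{0..}. ?f k (x + y) \<le> ?f s x + ?f t y" by blast
  next
    fix t c :: real and x :: 'a
    assume "t \<in> {0..}" "0 < c"
    then have "c * t \<in> {0..}" by simp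
    moreover have "?f (c * t) (c *\<^sub>R x) \<le> c * ?f t x"
      using sublinear_scale[OF p, of c "x + t *\<^sub>R h"] \<open>0 < c\<close> by (simp add: algebra_simps)
    ultimately show "\<exists>k\<in>{0..}. ?f k (c *\<^sub>R x) \<le> c * ?f t x" by blast
  qed simp
  show "?q \<le> p"
  proof (rule le_funI)
    show "?q x \<le> p x" for x
      using cINF_lower[OF bdd, of 0 x] by simp
  qed
  show "?q (- h) \<le> - p h"
    using cINF_lower[OF bdd, of 1 "- h"] sublinear_zero[OF p] by simp
qed

text \<open>Zorn's lemma for the reversed pointwise order. A nonempty chain is bounded by its
  pointwise infimum, which is finite because every member satisfies
  \<open>- p (- x) \<le> g x\<close>.\<close>

lemma minimal_sublinear_exists:
  fixes p :: "'a::real_vector \<Rightarrow> real"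
  assumes p: "sublinear p"
  obtains m where "sublinear m" "m \<le> p" "\<And>q. sublinear q \<Longrightarrow> q \<le> m \<Longrightarrow> q = m"
proof -
  let ?A = "{q. sublinear q \<and> q \<le> p}"
  have "\<exists>m\<in>?A. \<forall>a\<in>?A. m \<ge> a \<longrightarrow> a = m"
  proof (rule predicate_Zorn)
    show "partial_order_on ?A (relation_of (\<ge>) ?A)"
      by (rule partial_order_on_relation_ofI) auto
    fix C assume C: "C \<in> Chains (relation_of (\<ge>) ?A)"
    then have CA: "C \<subseteq> ?A" and total: "\<And>a b. a \<in> C \<Longrightarrow> b \<in> C \<Longrightarrow> a \<le> b \<or> b \<le> a"
      by (auto simp: Chains_def relation_of_def)
    show "\<exists>u\<in>?A. \<forall>a\<in>C. a \<ge> u"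
    proof (cases "C = {}")
      case True
      then show ?thesis using p by auto
    next
      case False
      let ?u = "\<lambda>x. INF g\<in>C. g x"
      have bdd: "bdd_below ((\<lambda>g. g x) ` C)" for x
      proof (rule bdd_belowI2)
        fix g assume "g \<in> C"
        then have "sublinear g" "g (- x) \<le> p (- x)" using CA by (auto simp: le_fun_def)
        then show "- p (- x) \<le> g x" using sublinear_minus[of g x] by simp
      qed
      have sub: "sublinear ?u"
      proof (rule sublinear_INF[OF False bdd])
        fix g h :: "'a \<Rightarrow> real" and x y :: 'a
        assume gh: "g \<in> C" "h \<in> C"
        then have "sublinear g" "sublinear h" using CA by auto
        \<comment> \<open>Of two members of a chain, the smaller one serves as the common index
          \<open>k\<close>.\<close>
        with total[OF gh] show "\<exists>k\<in>C. k (x + y) \<le> g x + h y"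
        proof (elim disjE)
          assume "g \<le> h"
          then have "g (x + y) \<le> g x + h y"
            using sublinear_add[OF \<open>sublinear g\<close>, of x y] le_funD[of g h y] by simp
          with gh show ?thesis by blast
        next
          assume "h \<le> g"
          then have "h (x + y) \<le> g x + h y"
            using sublinear_add[OF \<open>sublinear h\<close>, of x y] le_funD[of h g x] by simp
          with gh show ?thesis by blast
        qed
      next
        fix g :: "'a \<Rightarrow> real" and c :: real and x :: 'a
        assume "g \<in> C" "0 < c"
        then show "\<exists>k\<in>C. k (c *\<^sub>R x) \<le> c * g x"
          using CA by (intro bexI[of _ g]) (auto simp: sublinear_def)
      qed
      have le: "?u \<le> g" if "g \<in> C" for g
        using cINF_lower[OF bdd that] by (auto simp: le_fun_def)
      moreover obtain g where "g \<in> C" using False by blast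
      ultimately have "?u \<le> p" using CA by fastforce
      with sub le show ?thesis by blast
    qed
  qed
  \<comment> \<open>A sublinear functional below \<open>m\<close> is also below \<open>p\<close>, so
    it competes in \<open>?A\<close>.\<close>
  then show ?thesis
    using that by (metis (mono_tags, lifting) mem_Collect_eq order_trans)
qed

text \<open>A minimal sublinear functional is linear, because decreasing it at \<open>- h\<close> must not
  change it; starting below \<open>p\<close> with the value \<open>- p h\<close> at \<open>- h\<close> forces equality at \<open>h\<close>.\<close>

theorem hahn_banach_sublinear:
  fixes p :: "'a::real_vector \<Rightarrow> real"
  assumes p: "sublinear p"
  obtains f where "linear f" "\<And>x. f x \<le> p x" "f h = p h"
proof -
  obtain q where q: "sublinear q" "q \<le> p" "q (- h) \<le> - p h"
    using sublinear_decrease[OF p] by blast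
  obtain m where m: "sublinear m" "m \<le> q"
    and min: "\<And>r. sublinear r \<Longrightarrow> r \<le> m \<Longrightarrow> r = m"
    using minimal_sublinear_exists[OF q(1)] by blast
  have "m (- x) = - m x" for x
  proof -
    obtain r where "sublinear r" "r \<le> m" "r (- x) \<le> - m x"
      using sublinear_decrease[OF m(1)] by blast
    with min have "m (- x) \<le> - m x" by metis
    with sublinear_minus[OF m(1), of x] show ?thesis by simp
  qed
  with m(1) have "linear m" by (rule sublinear_odd_imp_linear)
  have le: "m x \<le> p x" for x
    using m(2) q(2) by (meson le_funD order_trans)
  have "m (- h) \<le> - p h"
    using le_funD[OF m(2), of "- h"] q(3) by simp
  then have "p h \<le> m h"
    using \<open>linear m\<close> by (simp add: linear_neg)
  with le[of h] have "m h = p h" by simp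
  with \<open>linear m\<close> le that show thesis by blast
qed

subsection \<open>One-sided directional derivatives of the norm\<close>

definition norm_quotient :: "'a::real_normed_vector \<Rightarrow> 'a \<Rightarrow> real \<Rightarrow> real" where
  "norm_quotient x h t = (norm (x + t *\<^sub>R h) - norm x) / t"

text \<open>The quotients increase with \<open>t\<close>, so this infimum is their limit as
  \<open>t\<close> decreases to 0, the right derivative along \<open>h\<close>. The infimum form
  exists without a limit argument and fits \<open>sublinear_INF\<close>.\<close>

definition norm_dir_deriv :: "'a::real_normed_vector \<Rightarrow> 'a \<Rightarrow> real" where
  "norm_dir_deriv x h = (INF t\<in>{0<..}. norm_quotient x h t)"

lemma norm_quotient_ge:
  assumes "0 < t"
  shows "- norm h \<le> norm_quotient x h t"
proof -
  have "norm x - norm (t *\<^sub>R h) \<le> norm (x + t *\<^sub>R h)"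
    by (metis norm_diff_ineq)
  then show ?thesis
    using assms by (simp add: norm_quotient_def field_simps)
qed

text \<open>Convexity of the norm along the ray: \<open>x + s h\<close> is the convex combination of
  \<open>x\<close> and \<open>x + t h\<close> with weight \<open>s / t\<close> on the
  latter.\<close>

lemma norm_quotient_mono:
  assumes "0 < s" "s \<le> t"
  shows "norm_quotient x h s \<le> norm_quotient x h t"
proof -
  have "x + s *\<^sub>R h = (1 - s / t) *\<^sub>R x + (s / t) *\<^sub>R (x + t *\<^sub>R h)"
    using assms by (simp add: algebra_simps)
  also have "norm \<dots> \<le> (1 - s / t) * norm x + (s / t) * norm (x + t *\<^sub>R h)"
    using assms by (intro norm_triangle_le) simp
  finally have "norm (x + s *\<^sub>R h) - norm x \<le> (s / t) * (norm (x + t *\<^sub>R h) - norm x)"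
    by (simp add: algebra_simps)
  then show ?thesis
    using assms by (simp add: norm_quotient_def field_simps)
qed

lemma bdd_below_norm_quotient: "bdd_below (norm_quotient x h ` {0<..})"
  by (rule bdd_belowI2[of _ "- norm h"]) (simp add: norm_quotient_ge)

lemma norm_dir_deriv_le: "0 < t \<Longrightarrow> norm_dir_deriv x h \<le> norm_quotient x h t"
  unfolding norm_dir_deriv_def by (rule cINF_lower[OF bdd_below_norm_quotient]) simp

lemma sublinear_norm_dir_deriv: "sublinear (norm_dir_deriv x)"
  unfolding norm_dir_deriv_def
proof (rule sublinear_INF)
  show "{0::real<..} \<noteq> {}" by auto
  show "bdd_below (norm_quotient x h ` {0<..})" for h
    by (rule bdd_below_norm_quotient)
  fix s :: real and h :: 'a
  assume s: "s \<in> {0<..}"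
  {
    fix t :: real and k :: 'a
    assume t: "t \<in> {0<..}"
    \<comment> \<open>The weights \<open>t / (s + t)\<close> and \<open>s / (s + t)\<close> turn
      both steps \<open>s\<close> and \<open>t\<close> into \<open>?r\<close>, so
      \<open>x + ?r (h + k)\<close> is a convex combination of \<open>x + s h\<close> and
      \<open>x + t k\<close>.\<close>
    let ?r = "s * t / (s + t)"
    have r: "0 < ?r" using s t by simp
    have "x + ?r *\<^sub>R (h + k) = (t / (s + t) + s / (s + t)) *\<^sub>R x + ?r *\<^sub>R (h + k)"
      using s t by (simp add: add.commute flip: add_divide_distrib)
    also have "\<dots> = (t / (s + t)) *\<^sub>R (x + s *\<^sub>R h) + (s / (s + t)) *\<^sub>R (x + t *\<^sub>R k)"
      by (simp add: algebra_simps)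
    also have "norm \<dots> \<le> t / (s + t) * norm (x + s *\<^sub>R h) + s / (s + t) * norm (x + t *\<^sub>R k)"
      using s t by (intro norm_triangle_le) simp
    finally have "norm_quotient x (h + k) ?r \<le>
        (t / (s + t) * norm (x + s *\<^sub>R h) + s / (s + t) * norm (x + t *\<^sub>R k) - norm x) / ?r"
      using r unfolding norm_quotient_def by (intro divide_right_mono) auto
    also have "\<dots> = norm_quotient x h s + norm_quotient x k t"
    proof -
      have "s + t \<noteq> 0" "s \<noteq> 0" "t \<noteq> 0" using s t by auto
      then show ?thesis
        unfolding norm_quotient_def by (simp add: divide_simps) (simp add: algebra_simps)
    qed
    finally show "\<exists>r\<in>{0<..}. norm_quotient x (h + k) r \<le> norm_quotient x h s + norm_quotient x k t"
      using r by (intro bexI[of _ ?r]) auto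
  }
  fix c :: real
  assume c: "0 < c"
  \<comment> \<open>The step \<open>s / c\<close> along \<open>c h\<close> reaches the same point as
    the step \<open>s\<close> along \<open>h\<close>.\<close>
  show "\<exists>r\<in>{0<..}. norm_quotient x (c *\<^sub>R h) r \<le> c * norm_quotient x h s"
    using s c by (intro bexI[of _ "s / c"]) (auto simp: norm_quotient_def field_simps)
qed

text \<open>Hahn-Banach with the right derivative as majorant. Bounding that derivative by the
  quotient at step 1 makes the functional a subgradient, and the triangle inequality then makes it
  continuous.\<close>

lemma norm_subgradient_exists:
  fixes x h :: "'a::real_normed_vector"
  obtains f :: "'a \<Rightarrow>\<^sub>L real"
  where "blinfun_apply f h = norm_dir_deriv x h"
    and "\<forall>z. norm x + blinfun_apply f (z - x) \<le> norm z"
proof -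
  obtain g where g: "linear g" "\<And>k. g k \<le> norm_dir_deriv x k" "g h = norm_dir_deriv x h"
    using hahn_banach_sublinear[OF sublinear_norm_dir_deriv] by blast
  have sub: "g (z - x) \<le> norm z - norm x" for z
    using g(2)[of "z - x"] norm_dir_deriv_le[of 1 x "z - x"] by (simp add: norm_quotient_def)
  have le: "g k \<le> norm k" for k
    using sub[of "x + k"] norm_triangle_ineq[of x k] by simp
  have "\<bar>g k\<bar> \<le> norm k" for k
    using le[of k] le[of "- k"] by (simp add: linear_neg[OF g(1)])
  then have "bounded_linear g"
    using g(1) by (intro bounded_linear_intro[where K = 1]) (auto simp: linear_add linear_scale)
  then have "blinfun_apply (Blinfun g) = g"
    by (rule bounded_linear_Blinfun_apply)
  with g(3) sub that[of "Blinfun g"] show thesis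
    by (simp add: algebra_simps)
qed

lemma norm_quotient_minus: "norm_quotient x h (- t) = - norm_quotient x (- h) t"
  by (simp add: norm_quotient_def)

text \<open>The left derivative along \<open>h\<close> is minus the right derivative along
  \<open>- h\<close>, so oddness says that the two one-sided derivatives agree.\<close>

lemma norm_has_real_derivative_dir_deriv:
  fixes x h :: "'a::real_normed_vector"
  assumes odd: "norm_dir_deriv x (- h) = - norm_dir_deriv x h"
  shows "((\<lambda>t. norm (x + t *\<^sub>R h)) has_real_derivative norm_dir_deriv x h) (at 0)"
proof -
  have close: "\<exists>d>0. \<forall>t. 0 < t \<and> t < d \<longrightarrow> \<bar>norm_quotient x k t - norm_dir_deriv x k\<bar> < e"
    if "0 < e" for e :: real and k :: 'a
  proof -
    have "Inf (norm_quotient x k ` {0<..}) < norm_dir_deriv x k + e"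
      using that by (simp add: norm_dir_deriv_def)
    then obtain d where d: "0 < d" "norm_quotient x k d < norm_dir_deriv x k + e"
      using bdd_below_norm_quotient by (subst (asm) cInf_less_iff) auto
    \<comment> \<open>Monotonicity of the quotient carries closeness at the single step
      \<open>d\<close> to all smaller steps.\<close>
    then have "\<bar>norm_quotient x k t - norm_dir_deriv x k\<bar> < e" if "0 < t" "t < d" for t
      using that norm_quotient_mono[of t d x k] norm_dir_deriv_le[of t x k] by simp
    with d(1) show ?thesis by blast
  qed
  have "norm_quotient x h \<midarrow>0\<rightarrow> norm_dir_deriv x h"
  proof (rule LIM_I)
    fix e :: real
    assume e: "0 < e"
    obtain d1 where d1: "0 < d1"
      "\<And>t. 0 < t \<Longrightarrow> t < d1 \<Longrightarrow> \<bar>norm_quotient x h t - norm_dir_deriv x h\<bar> < e"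
      using close[OF e, of h] by blast
    obtain d2 where d2: "0 < d2"
      "\<And>t. 0 < t \<Longrightarrow> t < d2 \<Longrightarrow> \<bar>norm_quotient x (- h) t - norm_dir_deriv x (- h)\<bar> < e"
      using close[OF e, of "- h"] by blast
    have "\<bar>norm_quotient x h t - norm_dir_deriv x h\<bar> < e"
      if t: "t \<noteq> 0" "\<bar>t\<bar> < min d1 d2" for t
    proof (cases "0 < t")
      case True
      then show ?thesis using t d1(2) by simp
    next
      case False
      then have "\<bar>norm_quotient x (- h) (- t) - norm_dir_deriv x (- h)\<bar> < e"
        using t by (intro d2(2)) auto
      then show ?thesis
        using norm_quotient_minus[of x h "- t"] odd by simp
    qed
    then show "\<exists>s>0. \<forall>t. t \<noteq> 0 \<and> norm (t - 0) < s \<longrightarrow>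
        norm (norm_quotient x h t - norm_dir_deriv x h) < e"
      using d1(1) d2(1) by (intro exI[of _ "min d1 d2"]) auto
  qed
  then show ?thesis
    by (simp add: DERIV_def norm_quotient_def[abs_def])
qed

subsection \<open>Convex combinations in normed spaces\<close>

lemma norm_convex_combination_le:
  fixes x y :: "'a::real_normed_vector"
  assumes "0 < t" "t < 1"
  shows "norm (t *\<^sub>R x + (1 - t) *\<^sub>R y) \<le> t * norm x + (1 - t) * norm y"
  using assms by (intro norm_triangle_le) simp

text \<open>Division by the common norm reduces to unit vectors, where the definition covers the
  midpoint. Other weights follow by convexity between midpoint and endpoint, with \<open>x\<close>
  and \<open>y\<close> swapped for \<open>t > 1/2\<close>.\<close>

lemma strictly_convex_space_imp_norm_less:
  fixes x y :: "'a::real_normed_vector"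
  assumes sc: "strictly_convex_space TYPE('a)"
    and eq: "norm x = norm y" and ne: "x \<noteq> y" and t: "0 < t" "t < 1"
  shows "norm (t *\<^sub>R x + (1 - t) *\<^sub>R y) < norm x"
proof -
  define r where "r = norm x"
  \<comment> \<open>A common norm 0 would give \<open>x = y = 0\<close>.\<close>
  have r: "0 < r" "norm y = r" using eq ne by (auto simp: r_def)
  let ?m = "(x + y) /\<^sub>R 2"
  have "norm ((x /\<^sub>R r + y /\<^sub>R r) /\<^sub>R 2) < 1"
    using sc ne r unfolding strictly_convex_space_def r_def by simp
  also have "(x /\<^sub>R r + y /\<^sub>R r) /\<^sub>R 2 = inverse r *\<^sub>R ?m"
    by (simp add: algebra_simps)
  also have "norm \<dots> = norm ?m / r"
    unfolding norm_scaleR using r(1) by (simp only: divide_inverse_commute) simp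
  finally have m: "norm ?m < r"
    using r(1) by (simp only: divide_less_eq_1_pos)
  have half: "norm (s *\<^sub>R u + (1 - s) *\<^sub>R v) < r"
    if s: "0 < s" "s \<le> 1/2" and uv: "(u + v) /\<^sub>R 2 = ?m" "norm v = r" for s and u v :: 'a
  proof -
    \<comment> \<open>For \<open>s \<le> 1/2\<close> the point lies between the midpoint and
      \<open>v\<close>, with positive weight \<open>2 * s\<close> on the midpoint.\<close>
    have "s *\<^sub>R u + (1 - s) *\<^sub>R v = (2 * s) *\<^sub>R ((u + v) /\<^sub>R 2) + (1 - 2 * s) *\<^sub>R v"
      by (simp add: algebra_simps) (metis mult_2_right scaleR_left_distrib)
    also have "norm \<dots> \<le> 2 * s * norm ?m + (1 - 2 * s) * r"
      unfolding uv(1) using s uv(2) by (intro norm_triangle_le) simp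
    also have "\<dots> < 2 * s * r + (1 - 2 * s) * r"
      using m s by simp
    finally show ?thesis by (simp add: algebra_simps)
  qed
  show ?thesis
  proof (cases "t \<le> 1/2")
    case True
    then show ?thesis using half[of t x y] t r by (simp add: r_def)
  next
    case False
    then show ?thesis
      using half[of "1 - t" y x] t by (simp add: r_def add.commute)
  qed
qed

subsection \<open>The primitive of a gauge\<close>

text \<open>The radial profile of the potential as a real function, so that calculus takes place on
  the half-line instead of in \<open>ereal\<close>.\<close>

definition gauge_primitive :: "(real \<Rightarrow> real) \<Rightarrow> real \<Rightarrow> real" where
  "gauge_primitive \<phi> r = integral {0..r} \<phi>"

lemma gauge_potential_eq: "gauge_potential \<phi> x = ereal (gauge_primitive \<phi> (norm x))"
  by (simp add: gauge_potential_def gauge_primitive_def)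

lemma proper_gauge_potential: "proper_fun (gauge_potential \<phi>)"
  by (simp add: proper_fun_def gauge_potential_eq)

lemma finiteness_domain_gauge_potential: "finiteness_domain (gauge_potential \<phi>) = UNIV"
  by (simp add: finiteness_domain_def gauge_potential_eq)

lemma gauge_primitive_0: "gauge_primitive \<phi> 0 = 0"
  by (simp add: gauge_primitive_def)

context
  fixes \<phi> :: "real \<Rightarrow> real"
  assumes gauge: "gauge_fun \<phi>"
begin

lemma gauge_zero: "\<phi> 0 = 0"
  using gauge by (simp add: gauge_fun_def)

lemma gauge_less: "0 \<le> a \<Longrightarrow> a < b \<Longrightarrow> \<phi> a < \<phi> b"
  using gauge by (auto simp: gauge_fun_def strict_mono_on_def)

lemma gauge_nonneg: "0 \<le> r \<Longrightarrow> 0 \<le> \<phi> r"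
  using gauge by (auto simp: gauge_fun_def)

lemma gauge_primitive_has_real_derivative:
  assumes "0 < r"
  shows "(gauge_primitive \<phi> has_real_derivative \<phi> r) (at r)"
proof -
  \<comment> \<open>Extending the interval to \<open>r + 1\<close> puts \<open>r\<close> in its
    interior.\<close>
  have "continuous_on {0..r + 1} \<phi>"
    using gauge by (auto simp: gauge_fun_def intro: continuous_on_subset)
  then have "(gauge_primitive \<phi> has_real_derivative \<phi> r) (at r within {0..r + 1})"
    using assms unfolding gauge_primitive_def[abs_def]
    by (intro integral_has_real_derivative) auto
  moreover have "at r within {0..r + 1} = at r"
    using assms by (intro at_within_interior) simp
  ultimately show ?thesis by simp
qed

lemma gauge_primitive_MVT:
  assumes "0 \<le> a" "a < b"
  shows "\<exists>c>a. c < b \<and> gauge_primitive \<phi> b - gauge_primitive \<phi> a = (b - a) * \<phi> c"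
proof (rule mvt[OF \<open>a < b\<close>, of "gauge_primitive \<phi>" "\<lambda>c. (*) (\<phi> c)"])
  have "continuous_on {0..b} \<phi>"
    using gauge by (auto simp: gauge_fun_def intro: continuous_on_subset)
  then have "continuous_on {0..b} (gauge_primitive \<phi>)"
    unfolding gauge_primitive_def[abs_def]
    by (intro indefinite_integral_continuous_1 integrable_continuous_real)
  then show "continuous_on {a..b} (gauge_primitive \<phi>)"
    by (rule continuous_on_subset) (use assms in auto)
  show "(gauge_primitive \<phi> has_derivative (*) (\<phi> c)) (at c)" if "a < c" "c < b" for c
    using gauge_primitive_has_real_derivative[of c] that assms
    by (simp add: has_field_derivative_def)
  show "\<exists>c>a. c < b \<and> gauge_primitive \<phi> b - gauge_primitive \<phi> a = (b - a) * \<phi> c"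
    if "a < c" "c < b" "gauge_primitive \<phi> b - gauge_primitive \<phi> a = \<phi> c * (b - a)" for c
    using that by (auto simp: mult.commute)
qed

text \<open>The mean value is \<open>\<phi> c\<close> with \<open>c\<close> strictly between
  \<open>a\<close> and \<open>b\<close>; strict monotonicity compares it with
  \<open>\<phi> a\<close> on either side.\<close>

lemma gauge_primitive_tangent_less:
  assumes "0 \<le> a" "0 \<le> b" "a \<noteq> b"
  shows "gauge_primitive \<phi> a + \<phi> a * (b - a) < gauge_primitive \<phi> b"
proof (cases "a < b")
  case True
  then obtain c where c: "a < c" "gauge_primitive \<phi> b - gauge_primitive \<phi> a = (b - a) * \<phi> c"
    using gauge_primitive_MVT[of a b] assms by metis
  have "(b - a) * \<phi> a < (b - a) * \<phi> c"
    using True gauge_less[OF assms(1) c(1)] by simp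
  with c show ?thesis by (simp add: algebra_simps)
next
  case False
  with assms have "b < a" by simp
  then obtain c where c: "b < c" "c < a"
    "gauge_primitive \<phi> a - gauge_primitive \<phi> b = (a - b) * \<phi> c"
    using gauge_primitive_MVT[of b a] assms by metis
  have "(a - b) * \<phi> c < (a - b) * \<phi> a"
    using \<open>b < a\<close> gauge_less[of c a] c assms by simp
  with c show ?thesis by (simp add: algebra_simps)
qed

lemma gauge_primitive_tangent:
  assumes "0 \<le> a" "0 \<le> b"
  shows "gauge_primitive \<phi> a + \<phi> a * (b - a) \<le> gauge_primitive \<phi> b"
  using gauge_primitive_tangent_less[OF assms] by (cases "a = b") auto

lemma gauge_primitive_less:
  assumes "0 \<le> a" "a < b"
  shows "gauge_primitive \<phi> a < gauge_primitive \<phi> b"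
proof -
  have "0 \<le> \<phi> a * (b - a)"
    using gauge_nonneg[OF assms(1)] assms by simp
  then show ?thesis
    using gauge_primitive_tangent_less[of a b] assms by simp
qed

lemma gauge_primitive_mono:
  assumes "0 \<le> a" "a \<le> b"
  shows "gauge_primitive \<phi> a \<le> gauge_primitive \<phi> b"
  using gauge_primitive_less[of a b] assms by (cases "a = b") auto

lemma gauge_primitive_convex:
  assumes "0 \<le> a" "0 \<le> b" "0 < t" "t < 1"
  shows "gauge_primitive \<phi> (t * a + (1 - t) * b)
    \<le> t * gauge_primitive \<phi> a + (1 - t) * gauge_primitive \<phi> b"
proof -
  let ?c = "t * a + (1 - t) * b"
  have "0 \<le> ?c" using assms by simp
  \<comment> \<open>Averaging the two tangent inequalities at \<open>?c\<close> cancels the linear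
    terms.\<close>
  have "gauge_primitive \<phi> ?c =
      t * (gauge_primitive \<phi> ?c + \<phi> ?c * (a - ?c))
      + (1 - t) * (gauge_primitive \<phi> ?c + \<phi> ?c * (b - ?c))"
    by (simp add: algebra_simps)
  also have "\<dots> \<le> t * gauge_primitive \<phi> a + (1 - t) * gauge_primitive \<phi> b"
    using assms \<open>0 \<le> ?c\<close>
    by (intro add_mono mult_left_mono gauge_primitive_tangent) auto
  finally show ?thesis .
qed

lemma gauge_primitive_strictly_convex:
  assumes "0 \<le> a" "0 \<le> b" "a \<noteq> b" "0 < t" "t < 1"
  shows "gauge_primitive \<phi> (t * a + (1 - t) * b)
    < t * gauge_primitive \<phi> a + (1 - t) * gauge_primitive \<phi> b"
proof -
  let ?c = "t * a + (1 - t) * b"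
  have "0 \<le> ?c" using assms by simp
  \<comment> \<open>\<open>?c\<close> differs from both endpoints, so both tangent inequalities at
    \<open>?c\<close> are strict.\<close>
  have "?c - a = (1 - t) * (b - a)" "?c - b = t * (a - b)"
    by (simp_all add: algebra_simps)
  with assms have "?c \<noteq> a" "?c \<noteq> b" by auto
  have "gauge_primitive \<phi> ?c =
      t * (gauge_primitive \<phi> ?c + \<phi> ?c * (a - ?c))
      + (1 - t) * (gauge_primitive \<phi> ?c + \<phi> ?c * (b - ?c))"
    by (simp add: algebra_simps)
  also have "\<dots> < t * gauge_primitive \<phi> a + (1 - t) * gauge_primitive \<phi> b"
    using assms \<open>0 \<le> ?c\<close> \<open>?c \<noteq> a\<close> \<open>?c \<noteq> b\<close>
    by (intro add_strict_mono mult_strict_left_mono gauge_primitive_tangent_less) auto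
  finally show ?thesis .
qed

subsection \<open>The potential of a gauge and its subdifferential\<close>

lemma convex_gauge_potential: "convex_ereal_fun (gauge_potential \<phi> :: 'a::real_normed_vector \<Rightarrow> ereal)"
  unfolding convex_ereal_fun_def
proof (intro allI impI)
  fix x y :: 'a and t :: real
  assume t: "0 < t" "t < 1"
  have "gauge_primitive \<phi> (norm (t *\<^sub>R x + (1 - t) *\<^sub>R y))
      \<le> gauge_primitive \<phi> (t * norm x + (1 - t) * norm y)"
    by (intro gauge_primitive_mono norm_convex_combination_le t) simp
  also have "\<dots> \<le> t * gauge_primitive \<phi> (norm x) + (1 - t) * gauge_primitive \<phi> (norm y)"
    by (intro gauge_primitive_convex t) auto
  finally show "gauge_potential \<phi> (t *\<^sub>R x + (1 - t) *\<^sub>R y)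
      \<le> ereal t * gauge_potential \<phi> x + ereal (1 - t) * gauge_potential \<phi> y"
    by (simp add: gauge_potential_eq)
qed

lemma lsc_gauge_potential: "lsc_fun (gauge_potential \<phi> :: 'a::real_normed_vector \<Rightarrow> ereal)"
  unfolding lsc_fun_def
proof
  fix x :: 'a
  show "gauge_potential \<phi> x \<le> Liminf (at x) (gauge_potential \<phi>)"
  proof (cases "at x = bot")
    \<comment> \<open>At an isolated point, as in the zero space, the \<open>Liminf\<close> over the
      trivial filter is the top element.\<close>
    case True
    then show ?thesis by simp
  next
    case False
    \<comment> \<open>The tangent of the primitive composed with the norm is a continuous minorant
      that touches the potential at \<open>x\<close>.\<close>
    let ?l = "\<lambda>z. ereal (gauge_primitive \<phi> (norm x) + \<phi> (norm x) * (norm z - norm x))"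
    have "((\<lambda>z. gauge_primitive \<phi> (norm x) + \<phi> (norm x) * (norm z - norm x))
        \<longlongrightarrow> gauge_primitive \<phi> (norm x) + \<phi> (norm x) * (norm x - norm x)) (at x)"
      by (intro tendsto_intros)
    then have "(?l \<longlongrightarrow> gauge_potential \<phi> x) (at x)"
      by (simp add: gauge_potential_eq)
    then have "gauge_potential \<phi> x = Liminf (at x) ?l"
      using lim_imp_Liminf[OF False] by metis
    also have "\<dots> \<le> Liminf (at x) (gauge_potential \<phi>)"
      by (intro Liminf_mono always_eventually)
        (simp add: gauge_potential_eq gauge_primitive_tangent)
    finally show ?thesis .
  qed
qed

lemma subdiff_gauge_potential_iff:
  "y \<in> subdiff (gauge_potential \<phi>) x \<longleftrightarrow>
    (\<forall>z. gauge_primitive \<phi> (norm x) + blinfun_apply y (z - x) \<le> gauge_primitive \<phi> (norm z))"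
  by (simp add: subdiff_def finiteness_domain_gauge_potential) (simp add: gauge_potential_eq)

lemma scaled_norm_subgradient_in_subdiff:
  fixes f :: "'a::real_normed_vector \<Rightarrow>\<^sub>L real"
  assumes "\<forall>z. norm x + blinfun_apply f (z - x) \<le> norm z"
  shows "\<phi> (norm x) *\<^sub>R f \<in> subdiff (gauge_potential \<phi>) x"
  unfolding subdiff_gauge_potential_iff
proof
  fix z
  have "\<phi> (norm x) * blinfun_apply f (z - x) \<le> \<phi> (norm x) * (norm z - norm x)"
    using spec[OF assms, of z] by (intro mult_left_mono gauge_nonneg) auto
  also have "gauge_primitive \<phi> (norm x) + \<dots> \<le> gauge_primitive \<phi> (norm z)"
    by (rule gauge_primitive_tangent) auto
  finally show "gauge_primitive \<phi> (norm x) + blinfun_apply (\<phi> (norm x) *\<^sub>R f) (z - x)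
      \<le> gauge_primitive \<phi> (norm z)"
    by (simp add: blinfun.scaleR_left)
qed

lemma dom_subdiff_gauge_potential:
  "dom_subdiff (gauge_potential \<phi> :: 'a::real_normed_vector \<Rightarrow> ereal) = UNIV"
proof -
  have "subdiff (gauge_potential \<phi>) x \<noteq> {}" for x :: 'a
  proof -
    obtain f :: "'a \<Rightarrow>\<^sub>L real" where "\<forall>z. norm x + blinfun_apply f (z - x) \<le> norm z"
      using norm_subgradient_exists[where x = x] by blast
    then show ?thesis
      using scaled_norm_subgradient_in_subdiff by blast
  qed
  then show ?thesis by (auto simp: dom_subdiff_def)
qed

section \<open>Uniqueness of subgradients and Gateaux differentiability of the norm\<close>

lemma subdiff_gauge_potential_0_eq_0:
  fixes y :: "'a::real_normed_vector \<Rightarrow>\<^sub>L real"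
  assumes "y \<in> subdiff (gauge_potential \<phi>) 0"
  shows "y = 0"
proof -
  \<comment> \<open>Testing along \<open>t h\<close> bounds \<open>y h\<close> by
    \<open>norm h * \<phi> (t * norm h)\<close>, which tends to 0 with \<open>t\<close> because
    \<open>\<phi>\<close> is continuous and vanishes at 0.\<close>
  have le: "blinfun_apply y h \<le> 0" for h
  proof -
    have bound: "blinfun_apply y h \<le> norm h * \<phi> (t * norm h)" if t: "0 < t" for t
    proof -
      have "t * blinfun_apply y h \<le> gauge_primitive \<phi> (t * norm h)"
        using assms[unfolded subdiff_gauge_potential_iff, rule_format, of "t *\<^sub>R h"] t
        by (simp add: gauge_primitive_0 blinfun.scaleR_right)
      \<comment> \<open>This is the tangent inequality at \<open>t * norm h\<close>, evaluated at
        0.\<close>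
      also have "\<dots> \<le> \<phi> (t * norm h) * (t * norm h)"
        using gauge_primitive_tangent[of "t * norm h" 0] t by (simp add: gauge_primitive_0)
      finally have "t * blinfun_apply y h \<le> t * (norm h * \<phi> (t * norm h))"
        by (simp add: algebra_simps)
      then show ?thesis using t by simp
    qed
    have "continuous_on {0..} \<phi>"
      using gauge by (simp add: gauge_fun_def)
    then have "continuous_on {0..} (\<lambda>t. \<phi> (t * norm h))"
      by (rule continuous_on_compose2) (auto intro!: continuous_intros)
    then have "continuous_on {0..} (\<lambda>t. norm h * \<phi> (t * norm h))"
      by (rule continuous_on_mult_left)
    then have "((\<lambda>t. norm h * \<phi> (t * norm h)) \<longlongrightarrow> norm h * \<phi> (0 * norm h)) (at 0 within {0..})"
      unfolding continuous_on_def by (rule bspec) simp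
    then have "((\<lambda>t. norm h * \<phi> (t * norm h)) \<longlongrightarrow> norm h * \<phi> (0 * norm h)) (at_right 0)"
      by (rule tendsto_within_subset) auto
    then have "((\<lambda>t. norm h * \<phi> (t * norm h)) \<longlongrightarrow> 0) (at_right 0)"
      by (simp add: gauge_zero)
    moreover have "\<forall>\<^sub>F t in at_right 0. blinfun_apply y h \<le> norm h * \<phi> (t * norm h)"
      using bound by (auto simp: eventually_at_filter)
    ultimately show ?thesis
      by (intro tendsto_lowerbound[where F = "at_right 0"]) auto
  qed
  show ?thesis
  proof (rule blinfun_eqI)
    show "blinfun_apply y h = blinfun_apply 0 h" for h
      using le[of h] le[of "- h"] by (simp add: blinfun.minus_right)
  qed
qed

text \<open>The potential minus the linear term of the subgradient is minimal at
  \<open>t = 0\<close> along the line, so its derivative, given by the chain rule, vanishes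
  there.\<close>

lemma subdiff_gauge_potential_eq_gateaux:
  fixes x :: "'a::real_normed_vector"
  assumes y: "y \<in> subdiff (gauge_potential \<phi>) x" and x: "x \<noteq> 0"
    and D: "((\<lambda>t. norm (x + t *\<^sub>R h)) has_real_derivative d) (at 0)"
  shows "blinfun_apply y h = \<phi> (norm x) * d"
proof -
  let ?g = "\<lambda>t. gauge_primitive \<phi> (norm (x + t *\<^sub>R h)) - t * blinfun_apply y h"
  have "((\<lambda>t. gauge_primitive \<phi> (norm (x + t *\<^sub>R h))) has_real_derivative \<phi> (norm x) * d) (at 0)"
    by (rule DERIV_chain2[OF _ D]) (use x gauge_primitive_has_real_derivative[of "norm x"] in simp)
  then have "(?g has_real_derivative \<phi> (norm x) * d - blinfun_apply y h) (at 0)"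
    by (auto intro!: derivative_eq_intros)
  moreover have "?g 0 \<le> ?g t" for t
    using y[unfolded subdiff_gauge_potential_iff, rule_format, of "x + t *\<^sub>R h"]
    by (simp add: blinfun.scaleR_right)
  ultimately have "\<phi> (norm x) * d - blinfun_apply y h = 0"
    by (intro DERIV_local_min[of ?g _ 0 1]) auto
  then show ?thesis by simp
qed

lemma gateaux_space_imp_essentially_gateaux:
  assumes "gateaux_differentiable_space TYPE('a::real_normed_vector)"
  shows "essentially_gateaux_differentiable (gauge_potential \<phi> :: 'a \<Rightarrow> ereal)"
proof -
  have unique: "y = y'"
    if "y \<in> subdiff (gauge_potential \<phi>) x" "y' \<in> subdiff (gauge_potential \<phi>) x"
    for x :: 'a and y y'
  proof (cases "x = 0")
    case True
    then show ?thesis using that subdiff_gauge_potential_0_eq_0 by blast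
  next
    case False
    then obtain D :: "'a \<Rightarrow>\<^sub>L real" where
      "\<And>h. ((\<lambda>t. norm (x + t *\<^sub>R h)) has_real_derivative blinfun_apply D h) (at 0)"
      using assms unfolding gateaux_differentiable_space_def gateaux_differentiable_at_def by blast
    then show ?thesis
      using subdiff_gauge_potential_eq_gateaux[OF _ False] that by (intro blinfun_eqI) metis
  qed
  then show ?thesis
    unfolding essentially_gateaux_differentiable_def finiteness_domain_gauge_potential
    by (auto simp: dom_subdiff_def intro!: is_singletonI')
qed

lemma essentially_gateaux_imp_gateaux_space:
  assumes "essentially_gateaux_differentiable (gauge_potential \<phi> :: 'a::real_normed_vector \<Rightarrow> ereal)"
  shows "gateaux_differentiable_space TYPE('a)"
  unfolding gateaux_differentiable_space_def
proof (intro allI impI)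
  fix x :: 'a
  assume "x \<noteq> 0"
  then have pos: "\<phi> (norm x) \<noteq> 0"
    using gauge_less[of 0 "norm x"] gauge_zero by simp
  have sing: "is_singleton (subdiff (gauge_potential \<phi>) x)"
    using assms dom_subdiff_gauge_potential
    by (auto simp: essentially_gateaux_differentiable_def)
  \<comment> \<open>Scaling by the nonzero \<open>\<phi> (norm x)\<close> is injective, so two
    subgradients of the norm would give two of the potential.\<close>
  have unique: "f = g"
    if "\<forall>z. norm x + blinfun_apply f (z - x) \<le> norm z"
      "\<forall>z. norm x + blinfun_apply g (z - x) \<le> norm z" for f g
  proof -
    have "\<phi> (norm x) *\<^sub>R f = \<phi> (norm x) *\<^sub>R g"
      using sing scaled_norm_subgradient_in_subdiff[OF that(1)]
        scaled_norm_subgradient_in_subdiff[OF that(2)]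
      by (auto elim!: is_singletonE)
    with pos show ?thesis by simp
  qed
  obtain f :: "'a \<Rightarrow>\<^sub>L real" where f: "\<forall>z. norm x + blinfun_apply f (z - x) \<le> norm z"
    using norm_subgradient_exists[where x = x] by blast
  \<comment> \<open>The subgradient attaining the right derivative along \<open>h\<close> must be
    \<open>f\<close>, whatever \<open>h\<close> is; hence the right derivative is odd in
    \<open>h\<close>.\<close>
  have deriv: "norm_dir_deriv x h = blinfun_apply f h" for h
  proof -
    obtain g :: "'a \<Rightarrow>\<^sub>L real" where "blinfun_apply g h = norm_dir_deriv x h"
      and g: "\<forall>z. norm x + blinfun_apply g (z - x) \<le> norm z"
      using norm_subgradient_exists[where x = x and h = h] by blast
    with unique[OF f g] show ?thesis by simp
  qed
  have "((\<lambda>t. norm (x + t *\<^sub>R h)) has_real_derivative blinfun_apply f h) (at 0)" for h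
    using norm_has_real_derivative_dir_deriv[of x h] by (simp add: deriv blinfun.minus_right)
  then show "gateaux_differentiable_at norm x"
    unfolding gateaux_differentiable_at_def by blast
qed

section \<open>Strict convexity of the potential and of the space\<close>

lemma strictly_convex_space_imp_strictly_convex_potential:
  assumes "strictly_convex_space TYPE('a::real_normed_vector)"
  shows "strictly_convex_ereal_on C (gauge_potential \<phi> :: 'a \<Rightarrow> ereal)"
  unfolding strictly_convex_ereal_on_def
proof (intro ballI allI impI)
  fix x y :: 'a and t :: real
  assume ne: "x \<noteq> y" and t: "0 < t" "t < 1"
  let ?F = "gauge_primitive \<phi>" and ?z = "t *\<^sub>R x + (1 - t) *\<^sub>R y"
  have "?F (norm ?z) < t * ?F (norm x) + (1 - t) * ?F (norm y)"
  \<comment> \<open>For equal norms strictness comes from the space, for different norms from the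
    primitive.\<close>
  proof (cases "norm x = norm y")
    case True
    then have "?F (norm ?z) < ?F (norm x)"
      by (intro gauge_primitive_less strictly_convex_space_imp_norm_less assms ne t) auto
    with True show ?thesis by (simp add: algebra_simps)
  next
    case False
    have "?F (norm ?z) \<le> ?F (t * norm x + (1 - t) * norm y)"
      by (intro gauge_primitive_mono norm_convex_combination_le t) simp
    also have "\<dots> < t * ?F (norm x) + (1 - t) * ?F (norm y)"
      by (intro gauge_primitive_strictly_convex t False) auto
    finally show ?thesis .
  qed
  then show "gauge_potential \<phi> ?z
      < ereal t * gauge_potential \<phi> x + ereal (1 - t) * gauge_potential \<phi> y"
    by (simp add: gauge_potential_eq)
qed

lemma strictly_convex_potential_imp_strictly_convex_space:
  assumes "strictly_convex_ereal_on UNIV (gauge_potential \<phi> :: 'a::real_normed_vector \<Rightarrow> ereal)"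
  shows "strictly_convex_space TYPE('a)"
  unfolding strictly_convex_space_def
proof (intro allI impI)
  fix x y :: 'a
  assume xy: "norm x = 1" "norm y = 1" "x \<noteq> y"
  let ?m = "(x + y) /\<^sub>R 2"
  have "?m = (1/2) *\<^sub>R x + (1 - 1/2) *\<^sub>R y"
    by (simp add: algebra_simps)
  moreover have "gauge_potential \<phi> ((1/2) *\<^sub>R x + (1 - 1/2) *\<^sub>R y)
      < ereal (1/2) * gauge_potential \<phi> x + ereal (1 - 1/2) * gauge_potential \<phi> y"
    by (rule assms[unfolded strictly_convex_ereal_on_def, rule_format]) (use xy(3) in auto)
  ultimately have "gauge_primitive \<phi> (norm ?m) < gauge_primitive \<phi> 1"
    using xy by (simp add: gauge_potential_eq)
  then show "norm ?m < 1"
    using gauge_primitive_mono[of 1 "norm ?m"] by (cases "norm ?m < 1") auto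
qed

section \<open>Local boundedness of the inverse subdifferential\<close>

lemma gauge_le_norm_subgradient:
  fixes x :: "'a::real_normed_vector"
  assumes y: "y \<in> subdiff (gauge_potential \<phi>) x" and x: "x \<noteq> 0"
  shows "\<phi> (norm x / 2) \<le> 2 * norm y"
proof -
  let ?r = "norm x"
  \<comment> \<open>The tangent at \<open>?r / 2\<close> bounds the primitive below by a value of
    the gauge itself; testing the subgradient at the origin bounds it above by
    \<open>y x\<close>.\<close>
  have "?r / 2 * \<phi> (?r / 2) \<le> gauge_primitive \<phi> ?r"
    using gauge_primitive_tangent[of "?r / 2" ?r] gauge_primitive_mono[of 0 "?r / 2"]
    by (simp add: gauge_primitive_0 algebra_simps)
  also have "\<dots> \<le> blinfun_apply y x"
    using y[unfolded subdiff_gauge_potential_iff, rule_format, of 0]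
    by (simp add: gauge_primitive_0 blinfun.minus_right)
  also have "\<dots> \<le> norm y * ?r"
    using norm_blinfun[of y x] by simp
  finally have "?r * \<phi> (?r / 2) \<le> ?r * (2 * norm y)" by (simp add: algebra_simps)
  with x show ?thesis by simp
qed

lemma locally_bounded_inv_subdiff_gauge_potential:
  "locally_bounded_on_domain (inv_subdiff (gauge_potential \<phi> :: 'a::real_normed_vector \<Rightarrow> ereal))"
  unfolding locally_bounded_on_domain_def
proof (intro allI impI)
  fix y :: "'a \<Rightarrow>\<^sub>L real"
  have "filterlim \<phi> at_top at_top"
    using gauge by (simp add: gauge_fun_def)
  then have "\<forall>\<^sub>F r in at_top. 2 * (norm y + 1) < \<phi> r"
    by (simp add: filterlim_at_top_dense)
  \<comment> \<open>Every \<open>z\<close> in the unit ball around \<open>y\<close> has norm at most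
    \<open>norm y + 1\<close>, so the preceding lemma rules out nonzero \<open>x\<close> with
    \<open>norm x / 2\<close> beyond \<open>R\<close>.\<close>
  then obtain R where R: "\<And>r. R \<le> r \<Longrightarrow> 2 * (norm y + 1) < \<phi> r"
    by (auto simp: eventually_at_top_linorder)
  \<comment> \<open>\<open>R\<close> may be negative; the maximum with 0 ensures that a violating
    \<open>x\<close> is nonzero.\<close>
  have "norm x \<le> max 0 (2 * R)" if "z \<in> ball y 1" "z \<in> subdiff (gauge_potential \<phi>) x"
    for x :: 'a and z
  proof (rule ccontr)
    assume "\<not> ?thesis"
    then have x: "x \<noteq> 0" "R \<le> norm x / 2" by auto
    have "norm z \<le> norm y + 1"
      using that(1) norm_triangle_sub[of z y] by (simp add: dist_norm norm_minus_commute)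
    with gauge_le_norm_subgradient[OF that(2) x(1)] R[OF x(2)] show False by simp
  qed
  then have "bounded (\<Union>z\<in>ball y 1. inv_subdiff (gauge_potential \<phi> :: 'a \<Rightarrow> ereal) z)"
    by (intro boundedI[of _ "max 0 (2 * R)"]) (auto simp: inv_subdiff_def)
  then show "\<exists>r>0. bounded (\<Union>z\<in>ball y r. inv_subdiff (gauge_potential \<phi> :: 'a \<Rightarrow> ereal) z)"
    using zero_less_one by blast
qed

end

theorem proposition3p14:
  fixes \<phi> :: "real \<Rightarrow> real"
  assumes "gauge_fun \<phi>"
  shows "euler_legendre (gauge_potential \<phi> :: 'a::banach \<Rightarrow> ereal) \<longleftrightarrow>
    strictly_convex_space TYPE('a) \<and> gateaux_differentiable_space TYPE('a)"
proof
  assume "euler_legendre (gauge_potential \<phi> :: 'a \<Rightarrow> ereal)"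
  \<comment> \<open>Every point carries a subgradient, so the whole space is an admissible convex
    set in the definition of essential strict convexity.\<close>
  then have "essentially_gateaux_differentiable (gauge_potential \<phi> :: 'a \<Rightarrow> ereal)"
    and "strictly_convex_ereal_on UNIV (gauge_potential \<phi> :: 'a \<Rightarrow> ereal)"
    using dom_subdiff_gauge_potential[OF assms, where 'a = 'a]
    by (auto simp: euler_legendre_def essentially_strictly_convex_def)
  then show "strictly_convex_space TYPE('a) \<and> gateaux_differentiable_space TYPE('a)"
    using essentially_gateaux_imp_gateaux_space[OF assms]
      strictly_convex_potential_imp_strictly_convex_space[OF assms] by blast
next
  assume "strictly_convex_space TYPE('a) \<and> gateaux_differentiable_space TYPE('a)"
  then show "euler_legendre (gauge_potential \<phi> :: 'a \<Rightarrow> ereal)"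
    unfolding euler_legendre_def essentially_strictly_convex_def
    using proper_gauge_potential convex_gauge_potential[OF assms] lsc_gauge_potential[OF assms]
      gateaux_space_imp_essentially_gateaux[OF assms, where 'a = 'a]
      strictly_convex_space_imp_strictly_convex_potential[OF assms, where 'a = 'a]
      locally_bounded_inv_subdiff_gauge_potential[OF assms] by auto
qed

end
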